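(* Let $d\ge 1$ be an integer, $p>0$, $\omega\in\mathbb{R}$, and let $V:\mathbb{R}^d\to\mathbb{R}$ be a $C^\infty$ spherically symmetric function, written $V(x)=V(|x|)$, that is repulsive, i.e. $V'(r)\le 0$ for all $r\ge 0$. Let $y:[0,\infty)\to\mathbb{R}$ be a smooth solution to $$-y''(r)-\tfrac{d-1}{r}\,y'(r)+V(r)y(r)-|y(r)|^p y(r)=-\omega\, y(r)\quad (r>0),\qquad y'(0)=0.$$ Then the successive local maxima of $|y(r)|$ form a non-increasing sequence as $r$ increases over the interval $[0,\infty)$; that is, if $0\le r<s$ are two points at which $|y|$ has local maxima (as a function on $[0,\infty)$), then $|y(s)|\le |y(r)|$.
   Context: For a spherically symmetric $V$ on $\mathbb{R}^d$ we abuse notation and write $V(r)$ for the value of $V$ at any point $x$ with $|x|=r$. Repulsive means $x\cdot\nabla V(x)\le 0$ for all $x\in\mathbb{R}^d$, equivalently $V'(r)\le 0$ for $r\ge 0$. The ODE is the radial equation satisfied by the profile $y$ of a solution $\psi(t,x)=e^{i\omega t}y(|x|)$ of the focusing nonlinear Schrödinger equation $i\partial_t\psi=-\Delta\psi+V\psi-|\psi|^p\psi$. *)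

theory Defs
  imports "HOL-Analysis.Analysis"
begin

text \<open>
  One-sided derivatives are meant at points of \<^term>\<open>S\<close> that are not interior. The derivative
  \<^term>\<open>f'\<close> is determined by \<^term>\<open>f\<close> on \<^term>\<open>S\<close> in the cases of interest, where \<^term>\<open>S\<close> is the whole
  space or the half line \<^term>\<open>{0::real..}\<close>.
\<close>

fun Ck_on :: "nat \<Rightarrow> 'a::real_normed_vector set \<Rightarrow> ('a \<Rightarrow> real) \<Rightarrow> bool" where
  "Ck_on 0 S f \<longleftrightarrow> continuous_on S f"
| "Ck_on (Suc k) S f \<longleftrightarrow>
     (\<exists>f'. (\<forall>x\<in>S. (f has_derivative f' x) (at x within S)) \<and> (\<forall>v. Ck_on k S (\<lambda>x. f' x v)))"

definition smooth_on :: "'a::real_normed_vector set \<Rightarrow> ('a \<Rightarrow> real) \<Rightarrow> bool" where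
  "smooth_on S f \<longleftrightarrow> (\<forall>k. Ck_on k S f)"

definition spherically_symmetric :: "('a::real_normed_vector \<Rightarrow> real) \<Rightarrow> bool" where
  "spherically_symmetric V \<longleftrightarrow> (\<forall>x x'. norm x = norm x' \<longrightarrow> V x = V x')"

text \<open>Only meaningful for spherically symmetric \<^term>\<open>V\<close> and \<^prop>\<open>(r::real) \<ge> 0\<close>.\<close>

definition radial_profile :: "('a::real_normed_vector \<Rightarrow> real) \<Rightarrow> real \<Rightarrow> real" where
  "radial_profile V r = (THE v. \<forall>x. norm x = r \<longrightarrow> V x = v)"

text \<open>The condition \<open>x \<bullet> \<nabla>V(x) \<le> 0\<close>, including the existence of the gradient.\<close>

definition repulsive :: "('a::real_inner \<Rightarrow> real) \<Rightarrow> bool" where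
  "repulsive V \<longleftrightarrow> (\<forall>x. \<exists>g. (GDERIV V x :> g) \<and> x \<bullet> g \<le> 0)"

definition local_max_on :: "real set \<Rightarrow> (real \<Rightarrow> real) \<Rightarrow> real \<Rightarrow> bool" where
  "local_max_on S f r \<longleftrightarrow> r \<in> S \<and> (\<exists>\<epsilon>>0. \<forall>t\<in>S. \<bar>t - r\<bar> < \<epsilon> \<longrightarrow> f t \<le> f r)"

lemma radial_profile_norm:
  assumes "spherically_symmetric V"
  shows "radial_profile V (norm x) = V x"
  unfolding radial_profile_def
  by (rule the_equality) (use assms[unfolded spherically_symmetric_def] in blast)+

lemma radial_profile_scaleR:
  assumes "spherically_symmetric V" "norm e = 1" "r \<ge> 0"
  shows "radial_profile V r = V (r *\<^sub>R e)"
  using radial_profile_norm[OF assms(1), of "r *\<^sub>R e"] assms(2,3) by simp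

lemma radial_profile_derivative:
  fixes V :: "'a::real_inner \<Rightarrow> real"
  assumes "spherically_symmetric V" "norm e = 1" "r \<ge> 0" "GDERIV V (r *\<^sub>R e) :> g"
  shows "(radial_profile V has_real_derivative (e \<bullet> g)) (at r within {0..})"
proof -
  have "((\<lambda>t. t *\<^sub>R e) has_derivative (\<lambda>h. h *\<^sub>R e)) (at r within {0..})"
    by (intro bounded_linear.has_derivative[OF bounded_linear_scaleR_left] has_derivative_ident)
  moreover have "(V has_derivative (\<lambda>h. h \<bullet> g)) (at (r *\<^sub>R e))"
    using assms(4) by (simp add: gderiv_def)
  ultimately have "((\<lambda>t. V (t *\<^sub>R e)) has_derivative (\<lambda>h. (h *\<^sub>R e) \<bullet> g)) (at r within {0..})"
    by (rule has_derivative_compose)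
  hence "((\<lambda>t. V (t *\<^sub>R e)) has_real_derivative (e \<bullet> g)) (at r within {0..})"
    by (simp add: has_field_derivative_def mult_commute_abs)
  thus ?thesis
    by (rule has_field_derivative_transform_within[OF _ zero_less_one])
       (use assms(3) radial_profile_scaleR[OF assms(1,2)] in simp_all)
qed

lemma spherically_symmetric_gderiv_0:
  fixes V :: "'a::real_inner \<Rightarrow> real"
  assumes "spherically_symmetric V" "GDERIV V 0 :> g"
  shows "g = 0"
proof -
  have d: "(V has_derivative (\<lambda>h. h \<bullet> g)) (at 0)"
    using assms(2) by (simp add: gderiv_def)
  have "((\<lambda>x. V (- x)) has_derivative (\<lambda>h. (- h) \<bullet> g)) (at 0)"
    by (rule has_derivative_compose[where f = uminus])
       (use d in \<open>simp_all add: has_derivative_minus\<close>)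
  moreover have "(\<lambda>x. V (- x)) = V"
    using assms(1)[unfolded spherically_symmetric_def] norm_minus_cancel by blast
  ultimately have "(\<lambda>h. (- h) \<bullet> g) = (\<lambda>h. h \<bullet> g)"
    using d by (metis has_derivative_unique)
  hence "- (g \<bullet> g) = g \<bullet> g"
    by (metis inner_minus_left)
  thus ?thesis by simp
qed

text \<open>The equivalent radial form \<open>V'(r) \<le> 0\<close> for \<open>r \<ge> 0\<close>.\<close>

lemma repulsive_iff_radial:
  fixes V :: "'a::euclidean_space \<Rightarrow> real"
  assumes sym: "spherically_symmetric V" and diff: "\<And>x. \<exists>g. GDERIV V x :> g"
  shows "repulsive V \<longleftrightarrow>
    (\<forall>r\<ge>0. \<exists>D\<le>0. (radial_profile V has_real_derivative D) (at r within {0..}))"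
proof (intro iffI allI impI)
  fix r :: real
  assume rep: "repulsive V" and r: "r \<ge> 0"
  obtain e :: 'a where e: "norm e = 1"
    by (metis SOME_Basis norm_Basis)
  obtain g where g: "GDERIV V (r *\<^sub>R e) :> g" "(r *\<^sub>R e) \<bullet> g \<le> 0"
    using rep unfolding repulsive_def by blast
  have "e \<bullet> g \<le> 0"
  proof (cases "r = 0")
    case True
    then have "g = 0" using spherically_symmetric_gderiv_0[OF sym, of g] g(1) by simp
    then show ?thesis by simp
  next
    case False
    then show ?thesis using g(2) r by (simp add: mult_le_0_iff)
  qed
  then show "\<exists>D\<le>0. (radial_profile V has_real_derivative D) (at r within {0..})"
    using radial_profile_derivative[OF sym e r g(1)] by blast
next
  assume rad: "\<forall>r\<ge>0. \<exists>D\<le>0. (radial_profile V has_real_derivative D) (at r within {0..})"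
  show "repulsive V"
    unfolding repulsive_def
  proof
    fix x
    obtain g where g: "GDERIV V x :> g" using diff by blast
    have "x \<bullet> g \<le> 0"
    proof (cases "x = 0")
      case False
      define e where "e = x /\<^sub>R norm x"
      have e: "norm e = 1" "norm x *\<^sub>R e = x" using False by (simp_all add: e_def)
      have 1: "(radial_profile V has_real_derivative (e \<bullet> g)) (at (norm x) within {0..})"
        by (rule radial_profile_derivative[OF sym e(1)]) (use g e in auto)
      obtain D where D: "D \<le> 0" "(radial_profile V has_real_derivative D) (at (norm x) within {0..})"
        using rad by (meson norm_ge_zero)
      have "at (norm x) within {0..} = at (norm x)"
        using False by (intro at_within_interior) (simp add: interior_real_atLeast)
      hence "e \<bullet> g = D"
        using 1 D(2) DERIV_unique by metis
      hence "norm x * (e \<bullet> g) \<le> 0"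
        using D(1) by (simp add: mult_nonneg_nonpos)
      thus ?thesis by (metis e(2) inner_scaleR_left)
    qed simp
    with g show "\<exists>g. (GDERIV V x :> g) \<and> x \<bullet> g \<le> 0" by blast
  qed
qed

end

theory Submission
  imports Defs
begin

text \<open>
  Put \<open>W = V + \<omega>\<close>, so that the equation reads
  \<open>y'' + (d - 1) y' / t = (W - |y|\<^sup>p) y\<close> with \<open>W\<close> non-increasing. The mechanical energy
  \<open>y'\<^sup>2/2 + |y|\<^bsup>p+2\<^esup>/(p+2) - W y\<^sup>2/2\<close> is dissipated by the damping term, but it gains
  \<open>- W' y\<^sup>2/2\<close> from the potential, so it is not monotone. The remedy is to shift it by
  \<open>W c\<^sup>2/2\<close> for a constant \<open>c\<close>: the gain becomes \<open>- W' (y\<^sup>2 - c\<^sup>2)/2\<close>, which is non-positive for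
  as long as \<open>|y| \<le> c\<close>, and at a point with \<open>|y| = c\<close> the term containing \<open>W\<close> disappears.

  Let \<open>|y|\<close> have a local maximum at \<open>r\<close> with value \<open>a > 0\<close>, and suppose that \<open>|y|\<close> exceeds \<open>a\<close>
  at some later point \<open>s\<close>. Let \<open>t\<close> be the first time after \<open>r\<close> with \<open>|y t| \<ge> |y s|\<close>,
  and let \<open>c = |y t| > a\<close>. Comparing the shifted energy at \<open>r\<close>, where \<open>y' = 0\<close>, and at \<open>t\<close> gives
  \<open>\<Phi> c \<le> \<Phi> a\<close> for \<open>\<Phi> u = u\<^bsup>p+2\<^esup>/(p+2) - W(r) u\<^sup>2/2\<close>
  (\<open>shifted_energy_antimono\<close>). But the local maximum forces \<open>W(r) \<le> a\<^sup>p\<close>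
  (\<open>local_max_potential_le\<close>), and \<open>\<Phi>\<close> is strictly increasing beyond such an \<open>a\<close>
  (\<open>potential_energy_strict_mono\<close>). So \<open>|y|\<close> never exceeds \<open>a\<close> after \<open>r\<close>.

  If \<open>a = 0\<close>, then \<open>y\<close> vanishes on an interval, and hence from there on by uniqueness for the
  initial value problem (\<open>zero_data_imp_zero\<close>).
\<close>

section \<open>The potential energy\<close>

text \<open>
  For \<open>p \<le> 1\<close> the function \<open>\<bar>u\<bar> powr p\<close> is not differentiable at the origin; the factor \<open>u\<^sup>2\<close>
  makes the energy density differentiable there, so that zeros of \<open>y\<close> are harmless.
\<close>

lemma abs_powr_times_square_deriv:
  fixes p u :: real
  assumes "p > 0"
  shows "((\<lambda>u. \<bar>u\<bar> powr p * u\<^sup>2 / (p + 2)) has_real_derivative \<bar>u\<bar> powr p * u) (at u)"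
proof (cases "u = 0")
  case True
  have "isCont (\<lambda>u. \<bar>u\<bar> powr p * u / (p + 2)) 0"
    using assms by (intro continuous_intros) auto
  then show ?thesis
    unfolding CARAT_DERIV using True
    by (intro exI[of _ "\<lambda>u. \<bar>u\<bar> powr p * u / (p + 2)"]) (auto simp: power2_eq_square)
next
  case False
  have abs: "(abs has_real_derivative sgn u) (at u)"
    using GDERIV_norm[OF False]
    by (simp add: gderiv_def has_field_derivative_def mult_commute_abs)
  have powr: "((\<lambda>u. \<bar>u\<bar> powr p) has_real_derivative p * \<bar>u\<bar> powr (p - 1) * sgn u) (at u)"
    using DERIV_chain2[OF has_real_derivative_powr[of "\<bar>u\<bar>" p] abs] False by simp
  have "((\<lambda>u. \<bar>u\<bar> powr p * u\<^sup>2 / (p + 2)) has_real_derivative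
      (p * \<bar>u\<bar> powr (p - 1) * sgn u * u\<^sup>2 + \<bar>u\<bar> powr p * (2 * u)) / (p + 2)) (at u)"
    by (rule DERIV_cong[OF DERIV_cdivide[OF DERIV_mult[OF powr DERIV_pow[of 2 u]]]]) simp
  moreover have "\<bar>u\<bar> powr (p - 1) * sgn u * u\<^sup>2 = \<bar>u\<bar> powr p * u"
  proof -
    have "\<bar>u\<bar> powr (p - 1) * \<bar>u\<bar> = \<bar>u\<bar> powr p"
      using False powr_mult_base[of "\<bar>u\<bar>" "p - 1"] by (simp add: mult.commute)
    moreover have "sgn u * u\<^sup>2 = \<bar>u\<bar> * u"
      by (simp add: power2_eq_square abs_sgn)
    ultimately show ?thesis
      by (metis mult.assoc)
  qed
  ultimately have "((\<lambda>u. \<bar>u\<bar> powr p * u\<^sup>2 / (p + 2)) has_real_derivative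
      (p * (\<bar>u\<bar> powr p * u) + \<bar>u\<bar> powr p * (2 * u)) / (p + 2)) (at u)"
    by (simp add: mult.assoc)
  moreover have "(p * (\<bar>u\<bar> powr p * u) + \<bar>u\<bar> powr p * (2 * u)) / (p + 2) = \<bar>u\<bar> powr p * u"
    using assms by (simp add: field_simps)
  ultimately show ?thesis by simp
qed

lemma potential_energy_strict_mono:
  fixes p a c w :: real
  assumes "p > 0" "0 < a" "a < c" "w \<le> a powr p"
  shows "a powr p * a\<^sup>2 / (p + 2) - w * a\<^sup>2 / 2 < c powr p * c\<^sup>2 / (p + 2) - w * c\<^sup>2 / 2"
proof -
  let ?\<Phi> = "\<lambda>u. \<bar>u\<bar> powr p * u\<^sup>2 / (p + 2) - w * u\<^sup>2 / 2"
  have deriv: "(?\<Phi> has_real_derivative \<bar>u\<bar> powr p * u - w * u) (at u)" for u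
    by (rule derivative_eq_intros abs_powr_times_square_deriv[OF assms(1)] | simp)+
  have "?\<Phi> a < ?\<Phi> c"
  proof (rule DERIV_pos_imp_increasing_open[OF \<open>a < c\<close>])
    fix u assume u: "a < u" "u < c"
    have "a powr p < u powr p"
      using assms u by (intro powr_less_mono2) auto
    then have "0 < (u powr p - w) * u"
      using assms u by (intro mult_pos_pos) auto
    then show "\<exists>D. (?\<Phi> has_real_derivative D) (at u) \<and> D > 0"
      using deriv[of u] assms u by (auto simp: algebra_simps)
  next
    show "continuous_on {a..c} ?\<Phi>"
      using deriv by (meson DERIV_continuous continuous_at_imp_continuous_on)
  qed
  then show ?thesis
    using assms by simp
qed

section \<open>The radial equation\<close>

text \<open>
  The equation is required only for \<open>t > 0\<close>, because of the singular coefficient; at the origin,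
  continuity of \<open>y'\<close> and \<open>y' 0 = 0\<close> take its place.
\<close>

locale radial_equation =
  fixes n :: nat and p :: real and W y y' :: "real \<Rightarrow> real"
  assumes p_pos: "p > 0"
    and W_deriv: "t \<ge> 0 \<Longrightarrow> \<exists>D\<le>0. (W has_real_derivative D) (at t within {0..})"
    and y_deriv: "t \<ge> 0 \<Longrightarrow> (y has_real_derivative y' t) (at t within {0..})"
    and y'_cont: "continuous_on {0..} y'"
    and y'_deriv: "t > 0 \<Longrightarrow>
      (y' has_real_derivative (W t - \<bar>y t\<bar> powr p) * y t - n / t * y' t) (at t)"
    and y'_0: "y' 0 = 0"
begin

lemma y_cont: "continuous_on {0..} y"
  using y_deriv by (auto simp: continuous_on_eq_continuous_within intro: DERIV_continuous)

lemma W_cont: "continuous_on {0..} W"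
  using W_deriv by (auto simp: continuous_on_eq_continuous_within intro: DERIV_continuous)

lemma powr_y_cont: "continuous_on {0..} (\<lambda>t. \<bar>y t\<bar> powr p)"
  using p_pos by (intro continuous_on_powr' continuous_intros y_cont) auto

lemma y_deriv_at: "t > 0 \<Longrightarrow> (y has_real_derivative y' t) (at t)"
  using y_deriv[of t] at_within_interior[of t "{0..}"] by (simp add: interior_real_atLeast)

lemma W_deriv_at: "t > 0 \<Longrightarrow> \<exists>D\<le>0. (W has_real_derivative D) (at t)"
  using W_deriv[of t] at_within_interior[of t "{0..}"] by (simp add: interior_real_atLeast)

lemma local_max_deriv_0:
  assumes "local_max_on {0..} (\<lambda>t. \<bar>y t\<bar>) r" "y r \<noteq> 0"
  shows "y' r = 0"
proof (cases "r = 0")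
  case True
  then show ?thesis by (simp add: y'_0)
next
  case False
  then have r: "r > 0" using assms(1) by (auto simp: local_max_on_def)
  obtain e where e: "e > 0" "\<And>t. t \<ge> 0 \<Longrightarrow> \<bar>t - r\<bar> < e \<Longrightarrow> \<bar>y t\<bar> \<le> \<bar>y r\<bar>"
    using assms(1) by (auto simp: local_max_on_def)
  have "((\<lambda>t. (y t)\<^sup>2) has_real_derivative 2 * y r * y' r) (at r)"
    using y_deriv_at[OF r] by (auto intro!: derivative_eq_intros)
  then have "2 * y r * y' r = 0"
  proof (rule DERIV_local_max)
    show "min e r > 0" using e r by simp
    show "\<forall>t. \<bar>r - t\<bar> < min e r \<longrightarrow> (y t)\<^sup>2 \<le> (y r)\<^sup>2"
      using e(2) by (auto simp: abs_le_square_iff[symmetric])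
  qed
  then show ?thesis using assms(2) by simp
qed

text \<open>
  In divergence form the equation is \<open>(t\<^sup>n y')' = t\<^sup>n (W - |y|\<^sup>p) y\<close>. Were \<open>W > |y|\<^sup>p\<close> at \<open>r\<close>, then
  \<open>t\<^sup>n y'\<close>, which vanishes at \<open>r\<close>, would acquire the sign of \<open>y\<close> to the right of \<open>r\<close>, and \<open>|y|\<close>
  would increase. Unlike the second derivative test, this covers \<open>r = 0\<close> as well.
\<close>

lemma local_max_potential_le:
  assumes max: "local_max_on {0..} (\<lambda>t. \<bar>y t\<bar>) r" and nz: "y r \<noteq> 0"
  shows "W r \<le> \<bar>y r\<bar> powr p"
proof (rule ccontr)
  assume "\<not> ?thesis"
  then have gt: "W r - \<bar>y r\<bar> powr p > 0" by simp
  obtain e where e: "e > 0" "\<And>t. t \<ge> 0 \<Longrightarrow> \<bar>t - r\<bar> < e \<Longrightarrow> \<bar>y t\<bar> \<le> \<bar>y r\<bar>" and r: "r \<ge> 0"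
    using max by (auto simp: local_max_on_def)
  define g where "g t = (W t - \<bar>y t\<bar> powr p) * (y t * y r)" for t
  have g_cont: "continuous_on {0..} g"
    unfolding g_def by (intro continuous_intros W_cont y_cont powr_y_cont)
  have "g r > 0"
    unfolding g_def by (rule mult_pos_pos) (use gt nz in \<open>simp_all flip: power2_eq_square\<close>)
  then obtain \<delta> where \<delta>: "\<delta> > 0" "\<And>t. t \<ge> 0 \<Longrightarrow> dist t r < \<delta> \<Longrightarrow> dist (g t) (g r) < g r"
    using g_cont r unfolding continuous_on_iff by (meson atLeast_iff)
  have g_pos: "g t > 0" if "r \<le> t" "t < r + \<delta>" for t
    using \<delta>(2)[of t] that r by (auto simp: dist_real_def)
  have y'_pos: "y' t * y r > 0" if t: "r < t" "t < r + \<delta>" for t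
  proof -
    have "r ^ n * y' r * y r < t ^ n * y' t * y r"
    proof (rule DERIV_pos_imp_increasing_open[OF t(1)])
      fix x assume x: "r < x" "x < t"
      have "x > 0" using x r by simp
      have "((\<lambda>t. t ^ n * y' t * y r) has_real_derivative
          (real n * x ^ (n - 1) * y' x +
            x ^ n * ((W x - \<bar>y x\<bar> powr p) * y x - n / x * y' x)) * y r) (at x)"
        using y'_deriv[OF \<open>x > 0\<close>] by (auto intro!: derivative_eq_intros)
      moreover have "(real n * x ^ (n - 1) * y' x +
            x ^ n * ((W x - \<bar>y x\<bar> powr p) * y x - n / x * y' x)) * y r = x ^ n * g x"
      proof (cases n)
        case (Suc m)
        then show ?thesis using \<open>x > 0\<close> by (simp add: g_def field_simps)
      qed (simp add: g_def)
      moreover have "x ^ n * g x > 0"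
        using g_pos[of x] x t \<open>x > 0\<close> by simp
      ultimately show "\<exists>D. ((\<lambda>t. t ^ n * y' t * y r) has_real_derivative D) (at x) \<and> D > 0"
        by metis
    next
      show "continuous_on {r..t} (\<lambda>t. t ^ n * y' t * y r)"
        using r by (intro continuous_intros continuous_on_subset[OF y'_cont]) auto
    qed
    then have "t ^ n * (y' t * y r) > 0"
      using local_max_deriv_0[OF max nz] by (simp add: mult.assoc)
    then show ?thesis
      using t r by (simp add: zero_less_mult_iff)
  qed
  define t where "t = r + min \<delta> e / 2"
  have t: "r < t" "t < r + \<delta>" "\<bar>t - r\<bar> < e"
    using \<delta>(1) e(1) by (auto simp: t_def min_def)
  have "y r * y r < y t * y r"
  proof (rule DERIV_pos_imp_increasing_open[OF t(1)])
    fix x assume x: "r < x" "x < t"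
    have "((\<lambda>t. y t * y r) has_real_derivative y' x * y r) (at x)"
      using y_deriv_at[of x] x r by (auto intro!: derivative_eq_intros)
    then show "\<exists>D. ((\<lambda>t. y t * y r) has_real_derivative D) (at x) \<and> D > 0"
      using y'_pos[of x] x t by auto
  next
    show "continuous_on {r..t} (\<lambda>t. y t * y r)"
      using r by (intro continuous_intros continuous_on_subset[OF y_cont]) auto
  qed
  also have "\<dots> \<le> \<bar>y t\<bar> * \<bar>y r\<bar>"
    by (metis abs_ge_self abs_mult)
  also have "\<dots> \<le> \<bar>y r\<bar> * \<bar>y r\<bar>"
    using e(2)[of t] t r by (intro mult_right_mono) auto
  finally show False by simp
qed

text \<open>
  The damping contributes \<open>- n y'\<^sup>2 / t\<close> to the derivative of the energy, and the varying potential
  \<open>- W' (y\<^sup>2 - c\<^sup>2) / 2\<close>; the bound \<open>|y| \<le> c\<close> is what gives the latter its sign.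
\<close>

lemma shifted_energy_antimono:
  fixes c :: real
  defines "E \<equiv> \<lambda>t. (y' t)\<^sup>2 / 2 + \<bar>y t\<bar> powr p * (y t)\<^sup>2 / (p + 2) - W t * ((y t)\<^sup>2 - c\<^sup>2) / 2"
  assumes "0 \<le> r" "r \<le> t" and le: "\<And>x. r < x \<Longrightarrow> x < t \<Longrightarrow> \<bar>y x\<bar> \<le> c"
  shows "E t \<le> E r"
proof (rule DERIV_nonpos_imp_decreasing_open[OF \<open>r \<le> t\<close>])
  fix x assume x: "r < x" "x < t"
  then have x0: "x > 0" using \<open>0 \<le> r\<close> by simp
  obtain D where D: "D \<le> 0" "(W has_real_derivative D) (at x)"
    using W_deriv_at[OF x0] by blast
  have "((\<lambda>t. \<bar>y t\<bar> powr p * (y t)\<^sup>2 / (p + 2)) has_real_derivative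
      (\<bar>y x\<bar> powr p * y x) * y' x) (at x)"
    by (rule DERIV_chain2[OF abs_powr_times_square_deriv[OF p_pos] y_deriv_at[OF x0]])
  moreover have "((\<lambda>t. (y' t)\<^sup>2 / 2) has_real_derivative
      y' x * ((W x - \<bar>y x\<bar> powr p) * y x - n / x * y' x)) (at x)"
    using y'_deriv[OF x0] by (auto intro!: derivative_eq_intros)
  moreover have "((\<lambda>t. W t * ((y t)\<^sup>2 - c\<^sup>2) / 2) has_real_derivative
      D * ((y x)\<^sup>2 - c\<^sup>2) / 2 + W x * (y x * y' x)) (at x)"
    using D(2) y_deriv_at[OF x0] by (auto intro!: derivative_eq_intros simp: field_simps)
  ultimately have "(E has_real_derivative
      y' x * ((W x - \<bar>y x\<bar> powr p) * y x - n / x * y' x) + (\<bar>y x\<bar> powr p * y x) * y' x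
        - (D * ((y x)\<^sup>2 - c\<^sup>2) / 2 + W x * (y x * y' x))) (at x)"
    unfolding E_def by (intro DERIV_add DERIV_diff)
  moreover have "y' x * ((W x - \<bar>y x\<bar> powr p) * y x - n / x * y' x) + (\<bar>y x\<bar> powr p * y x) * y' x
        - (D * ((y x)\<^sup>2 - c\<^sup>2) / 2 + W x * (y x * y' x))
      = - (n / x * (y' x)\<^sup>2) - D * ((y x)\<^sup>2 - c\<^sup>2) / 2"
    by (simp add: algebra_simps power2_eq_square)
  ultimately have deriv: "(E has_real_derivative - (n / x * (y' x)\<^sup>2) - D * ((y x)\<^sup>2 - c\<^sup>2) / 2) (at x)"
    by (simp only:)
  have "n / x * (y' x)\<^sup>2 \<ge> 0"
    using x0 by simp
  moreover have "(y x)\<^sup>2 \<le> c\<^sup>2"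
    using le[OF x] by (metis abs_ge_zero power2_abs power_mono)
  then have "D * ((y x)\<^sup>2 - c\<^sup>2) \<ge> 0"
    using D(1) by (intro mult_nonpos_nonpos) auto
  ultimately have "- (n / x * (y' x)\<^sup>2) - D * ((y x)\<^sup>2 - c\<^sup>2) / 2 \<le> 0"
    by simp
  with deriv show "\<exists>D. (E has_real_derivative D) (at x) \<and> D \<le> 0"
    by blast
next
  show "continuous_on {r..t} E"
    unfolding E_def
    using \<open>0 \<le> r\<close> p_pos
    by (intro continuous_on_add continuous_on_diff continuous_on_divide continuous_on_mult
        continuous_on_power continuous_on_const continuous_on_subset[OF y'_cont]
        continuous_on_subset[OF y_cont] continuous_on_subset[OF powr_y_cont]
        continuous_on_subset[OF W_cont]) auto
qed

text \<open>
  Gronwall's argument: \<open>(y\<^sup>2 + y'\<^sup>2)' \<le> B (y\<^sup>2 + y'\<^sup>2)\<close>, where \<open>B\<close> bounds the coefficient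
  \<open>1 + W - |y|\<^sup>p\<close>; the damping term has the favourable sign.
\<close>

lemma zero_data_imp_zero:
  assumes "r > 0" "y r = 0" "y' r = 0" "r \<le> s"
  shows "y s = 0"
proof -
  define q where "q t = 1 + W t - \<bar>y t\<bar> powr p" for t
  have "continuous_on {r..s} q"
    unfolding q_def
    using \<open>r > 0\<close> by (intro continuous_intros continuous_on_subset[OF powr_y_cont]
      continuous_on_subset[OF W_cont]) auto
  then have "bounded (q ` {r..s})"
    by (intro compact_imp_bounded compact_continuous_image) auto
  then obtain B where B: "\<And>t. r \<le> t \<Longrightarrow> t \<le> s \<Longrightarrow> \<bar>q t\<bar> \<le> B"
    unfolding bounded_iff by (metis atLeastAtMost_iff imageI real_norm_def)
  define N where "N t = ((y t)\<^sup>2 + (y' t)\<^sup>2) * exp (- B * t)" for t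
  have "N s \<le> N r"
  proof (rule DERIV_nonpos_imp_nonincreasing[OF \<open>r \<le> s\<close>])
    fix x assume x: "r \<le> x" "x \<le> s"
    then have x0: "x > 0" using \<open>r > 0\<close> by simp
    have "(N has_real_derivative
        (2 * y x * y' x + 2 * y' x * ((W x - \<bar>y x\<bar> powr p) * y x - n / x * y' x)) * exp (- B * x)
          + ((y x)\<^sup>2 + (y' x)\<^sup>2) * (exp (- B * x) * (- B))) (at x)"
      unfolding N_def using y_deriv_at[OF x0] y'_deriv[OF x0]
      by (auto intro!: derivative_eq_intros)
    moreover have "(2 * y x * y' x + 2 * y' x * ((W x - \<bar>y x\<bar> powr p) * y x - n / x * y' x)) * exp (- B * x)
          + ((y x)\<^sup>2 + (y' x)\<^sup>2) * (exp (- B * x) * (- B))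
        = (q x * (2 * y x * y' x) - B * ((y x)\<^sup>2 + (y' x)\<^sup>2) - 2 * (n / x * (y' x)\<^sup>2)) * exp (- B * x)"
      by (simp add: q_def algebra_simps power2_eq_square)
    ultimately have deriv: "(N has_real_derivative
        (q x * (2 * y x * y' x) - B * ((y x)\<^sup>2 + (y' x)\<^sup>2) - 2 * (n / x * (y' x)\<^sup>2)) * exp (- B * x)) (at x)"
      by (simp only:)
    have "q x * (2 * y x * y' x) \<le> B * ((y x)\<^sup>2 + (y' x)\<^sup>2)"
    proof -
      have "\<bar>2 * y x * y' x\<bar> \<le> (y x)\<^sup>2 + (y' x)\<^sup>2"
        using sum_squares_bound[of "\<bar>y x\<bar>" "\<bar>y' x\<bar>"] by (simp add: abs_mult)
      then have "\<bar>q x\<bar> * \<bar>2 * y x * y' x\<bar> \<le> B * ((y x)\<^sup>2 + (y' x)\<^sup>2)"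
        using B[OF x] by (intro mult_mono) auto
      then show ?thesis
        by (metis abs_ge_self abs_mult order_trans)
    qed
    moreover have "n / x * (y' x)\<^sup>2 \<ge> 0"
      using x0 by simp
    ultimately have
        "(q x * (2 * y x * y' x) - B * ((y x)\<^sup>2 + (y' x)\<^sup>2) - 2 * (n / x * (y' x)\<^sup>2)) * exp (- B * x) \<le> 0"
      by (intro mult_nonpos_nonneg) auto
    with deriv show "\<exists>D. (N has_real_derivative D) (at x) \<and> D \<le> 0"
      by blast
  qed
  moreover have "N r = 0"
    using assms by (simp add: N_def)
  ultimately have "(y s)\<^sup>2 + (y' s)\<^sup>2 \<le> 0"
    by (simp add: N_def mult_le_0_iff)
  then show ?thesis
    using sum_power2_le_zero_iff by blast
qed

lemma local_max_zero_imp_zero: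
  assumes max: "local_max_on {0..} (\<lambda>t. \<bar>y t\<bar>) r" and "y r = 0" "r < s"
  shows "y s = 0"
proof -
  obtain e where e: "e > 0" "\<And>t. t \<ge> 0 \<Longrightarrow> \<bar>t - r\<bar> < e \<Longrightarrow> y t = 0" and r: "r \<ge> 0"
    using max \<open>y r = 0\<close> by (auto simp: local_max_on_def)
  \<comment> \<open>A point strictly to the right of \<open>r\<close> is needed, since \<open>r\<close> may be the singular point \<open>0\<close>.\<close>
  define r' where "r' = r + min (e / 2) (s - r)"
  have r': "r < r'" "r' < r + e" "r' \<le> s"
    using e(1) \<open>r < s\<close> by (auto simp: r'_def min_def)
  define \<delta> where "\<delta> = min (r' - r) (r + e - r')"
  have flat: "y t = 0" if "\<bar>r' - t\<bar> < \<delta>" for t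
    using that r by (intro e(2)) (auto simp: \<delta>_def)
  have "y' r' = 0"
    by (rule DERIV_local_const[OF y_deriv_at, where d = \<delta>])
       (use r r' flat flat[of r'] in \<open>auto simp: \<delta>_def\<close>)
  moreover have "y r' = 0"
    using r r' by (intro e(2)) auto
  ultimately show ?thesis
    using zero_data_imp_zero[of r' s] r r' by simp
qed

theorem local_max_bounds_later_values:
  assumes max: "local_max_on {0..} (\<lambda>t. \<bar>y t\<bar>) r" and "r < s"
  shows "\<bar>y s\<bar> \<le> \<bar>y r\<bar>"
proof (cases "y r = 0")
  case True
  then show ?thesis using local_max_zero_imp_zero[OF max _ \<open>r < s\<close>] by simp
next
  case False
  have r: "r \<ge> 0" using max by (simp add: local_max_on_def)
  show ?thesis
  proof (rule ccontr)
    assume "\<not> ?thesis"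
    then have gt: "\<bar>y r\<bar> < \<bar>y s\<bar>" by simp
    define T where "T = {t \<in> {r..s}. \<bar>y s\<bar> \<le> \<bar>y t\<bar>}"
    have cont: "continuous_on {r..s} (\<lambda>t. \<bar>y t\<bar>)"
      using r by (intro continuous_intros continuous_on_subset[OF y_cont]) auto
    have "T = {r..s} \<inter> (\<lambda>t. \<bar>y t\<bar>) -` {\<bar>y s\<bar>..}"
      by (auto simp: T_def)
    then have "closed T"
      using continuous_closed_preimage[OF cont, of "{\<bar>y s\<bar>..}"] by simp
    then have "compact T"
      unfolding compact_eq_bounded_closed
      by (auto simp: T_def intro: bounded_subset[OF bounded_closed_interval[of r s]])
    moreover have "s \<in> T" using \<open>r < s\<close> by (simp add: T_def)
    ultimately obtain t where t: "t \<in> T" "\<And>x. x \<in> T \<Longrightarrow> t \<le> x"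
      using compact_attains_inf[of T] by blast
    have below: "\<bar>y x\<bar> \<le> \<bar>y t\<bar>" if "r < x" "x < t" for x
    proof -
      have "x \<notin> T" using t(2)[of x] that by auto
      then have "\<bar>y x\<bar> < \<bar>y s\<bar>" using t(1) that by (auto simp: T_def)
      then show ?thesis using t(1) by (simp add: T_def)
    qed
    have "\<bar>y t\<bar> > \<bar>y r\<bar>" "r \<le> t"
      using t(1) gt by (auto simp: T_def)
    have "(y' t)\<^sup>2 / 2 + \<bar>y t\<bar> powr p * (y t)\<^sup>2 / (p + 2)
        \<le> \<bar>y r\<bar> powr p * (y r)\<^sup>2 / (p + 2) - W r * ((y r)\<^sup>2 - (y t)\<^sup>2) / 2"
      using shifted_energy_antimono[OF r \<open>r \<le> t\<close> below]
      by (simp add: local_max_deriv_0[OF max False])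
    moreover have "\<bar>y r\<bar> powr p * (y r)\<^sup>2 / (p + 2) - W r * (y r)\<^sup>2 / 2
        < \<bar>y t\<bar> powr p * (y t)\<^sup>2 / (p + 2) - W r * (y t)\<^sup>2 / 2"
      using potential_energy_strict_mono[OF p_pos _ \<open>\<bar>y t\<bar> > \<bar>y r\<bar>\<close> local_max_potential_le[OF max False]]
        False by simp
    moreover have "(y' t)\<^sup>2 / 2 \<ge> 0" by simp
    ultimately show False
      by (simp add: right_diff_distrib diff_divide_distrib)
  qed
qed

end

section \<open>Monotonicity of the maxima\<close>

lemma Ck_on_Suc_real_deriv:
  fixes f :: "real \<Rightarrow> real"
  assumes "Ck_on (Suc k) S f"
  obtains g where "\<And>x. x \<in> S \<Longrightarrow> (f has_real_derivative g x) (at x within S)" "Ck_on k S g"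
proof -
  obtain f' where f': "\<And>x. x \<in> S \<Longrightarrow> (f has_derivative f' x) (at x within S)"
    "\<And>v. Ck_on k S (\<lambda>x. f' x v)"
    using assms by auto
  have "(f has_real_derivative f' x 1) (at x within S)" if "x \<in> S" for x
  proof -
    define D where "D = f' x 1"
    have "f' x h = D * h" for h
      using linear_cmul[OF has_derivative_linear[OF f'(1)[OF that]], of h 1]
      by (simp add: D_def mult.commute)
    then have "f' x = (*) D" by blast
    then show ?thesis
      using f'(1)[OF that] by (simp add: has_field_derivative_def)
  qed
  then show ?thesis using that[of "\<lambda>x. f' x 1"] f'(2) by blast
qed

theorem theorem2p1:
  fixes V :: "real ^ 'n \<Rightarrow> real"
    and p \<omega> :: real
    and y :: "real \<Rightarrow> real"
  assumes "p > 0"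
    and "smooth_on UNIV V"
    and "spherically_symmetric V"
    and "repulsive V"
    and "smooth_on {0..} y"
    and "\<And>r. r > 0 \<Longrightarrow>
      - deriv (deriv y) r - (real CARD('n) - 1) / r * deriv y r
        + radial_profile V r * y r - \<bar>y r\<bar> powr p * y r = - \<omega> * y r"
    and "(y has_real_derivative 0) (at 0 within {0..})"
  shows "\<forall>r s. 0 \<le> r \<longrightarrow> r < s \<longrightarrow>
      local_max_on {0..} (\<lambda>t. \<bar>y t\<bar>) r \<longrightarrow> local_max_on {0..} (\<lambda>t. \<bar>y t\<bar>) s \<longrightarrow>
      \<bar>y s\<bar> \<le> \<bar>y r\<bar>"
proof -
  have "Ck_on (Suc (Suc 0)) {0..} y"
    using assms(5) unfolding smooth_on_def by blast
  then obtain y' where y': "\<And>t. t \<in> {0..} \<Longrightarrow> (y has_real_derivative y' t) (at t within {0..})"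
    and Ck_y': "Ck_on (Suc 0) {0..} y'"
    by (rule Ck_on_Suc_real_deriv) blast
  obtain y'' where y'': "\<And>t. t \<in> {0..} \<Longrightarrow> (y' has_real_derivative y'' t) (at t within {0..})"
    using Ck_y' by (rule Ck_on_Suc_real_deriv) blast
  have at: "at t within {0..} = at t" if "t > 0" for t :: real
    using that by (intro at_within_interior) (simp add: interior_real_atLeast)
  have deriv_y: "deriv y t = y' t" if "t > 0" for t
    using y'[of t] that at by (intro DERIV_imp_deriv) simp
  have deriv_y': "(y' has_real_derivative y'' t) (at t)" if "t > 0" for t
    using y''[of t] that at by simp
  have deriv2_y: "deriv (deriv y) t = y'' t" if "t > 0" for t
  proof -
    have "\<forall>\<^sub>F x in nhds t. deriv y x = y' x"
      using eventually_nhds_in_open[of "{0<..}" t] that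
      by (auto elim!: eventually_mono simp: deriv_y)
    then have "deriv (deriv y) t = deriv y' t"
      by (intro deriv_cong_ev) auto
    then show ?thesis
      using DERIV_imp_deriv[OF deriv_y'[OF that]] by simp
  qed
  interpret radial_equation "CARD('n) - 1" p "\<lambda>t. radial_profile V t + \<omega>" y y'
  proof
    show "p > 0" by fact
    show "continuous_on {0..} y'"
      using y'' by (auto simp: continuous_on_eq_continuous_within intro: DERIV_continuous)
    have "at (0::real) within {0..} \<noteq> bot"
      by (simp add: at_within_Ici_at_right)
    then show "y' 0 = 0"
      using has_field_derivative_unique[OF y'[of 0] assms(7)] by simp
  next
    fix t :: real assume t: "t \<ge> 0"
    show "(y has_real_derivative y' t) (at t within {0..})"
      using y' t by simp
    have "\<exists>D\<le>0. (radial_profile V has_real_derivative D) (at t within {0..})"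
      using repulsive_iff_radial[OF assms(3)] assms(4) t unfolding repulsive_def by blast
    then show "\<exists>D\<le>0. ((\<lambda>t. radial_profile V t + \<omega>) has_real_derivative D) (at t within {0..})"
      by (auto intro!: derivative_eq_intros)
  next
    fix t :: real assume t: "t > 0"
    have "real (CARD('n) - 1) = real CARD('n) - 1"
      by (simp add: of_nat_diff Suc_leI)
    then have "y'' t = (radial_profile V t + \<omega> - \<bar>y t\<bar> powr p) * y t
        - real (CARD('n) - 1) / t * y' t"
      using assms(6)[OF t] deriv_y[OF t] deriv2_y[OF t] by (simp add: algebra_simps)
    then show "(y' has_real_derivative (radial_profile V t + \<omega> - \<bar>y t\<bar> powr p) * y t
        - real (CARD('n) - 1) / t * y' t) (at t)"
      using deriv_y'[OF t] by simp
  qed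
  show ?thesis
    using local_max_bounds_later_values by blast
qed

end
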